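(* Let $M$ be an infinite compact metric space (with an arbitrary distinguished point $0\in M$). Then the set $\operatorname{SNA}(M)$ contains an isometric copy of $c_0$.
   Context: All vector spaces are real. Let $(M,d)$ be a pointed metric space, i.e. a metric space with a distinguished point $0\in M$ (its choice is irrelevant, since $f\mapsto f-f(0)$ is a linear isometry between the corresponding spaces preserving strong norm attainment). $\operatorname{Lip}_0(M)$ is the Banach space of all Lipschitz functions $f:M\to\mathbb{R}$ with $f(0)=0$, with norm $\|f\|_{\operatorname{Lip}}=\sup\{|f(y)-f(x)|/d(x,y): x,y\in M,\ x\ne y\}$. A function $f\in\operatorname{Lip}_0(M)$ strongly attains its norm if there are distinct $p,q\in M$ with $\|f\|_{\operatorname{Lip}}=|f(p)-f(q)|/d(p,q)$. $\operatorname{SNA}(M)\subseteq\operatorname{Lip}_0(M)$ is the set of all functions that strongly attain their norm. $\operatorname{SNA}(M)$ contains an isometric copy of a Banach space $Y$ if there is a linear isometric embedding $U:Y\to\operatorname{Lip}_0(M)$ with $U(Y)\subseteq\operatorname{SNA}(M)$. $c_0$ is the space of real sequences converging to $0$ with the supremum norm. *)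

theory Defs
  imports "HOL-Analysis.Analysis"
begin

text \<open>A metric space is the set \<open>M\<close> with the restriction of \<^term>\<open>dist\<close>; \<open>z \<in> M\<close> is its
  distinguished point. A function on \<open>M\<close> is represented by its extension by \<open>0\<close> to the whole type,
  so that equality and the pointwise operations of functions are those on \<open>M\<close>.\<close>

definition Lip0 :: "'a::metric_space set \<Rightarrow> 'a \<Rightarrow> ('a \<Rightarrow> real) set" where
  "Lip0 M z = {f. (\<exists>C. C-lipschitz_on M f) \<and> f z = 0 \<and> (\<forall>p. p \<notin> M \<longrightarrow> f p = 0)}"

text \<open>The supremum below is the intended one only if \<open>M\<close> has at least two points, since the
  supremum of the empty set of reals is unspecified.\<close>

definition lip_norm :: "'a::metric_space set \<Rightarrow> ('a \<Rightarrow> real) \<Rightarrow> real" where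
  "lip_norm M f =
     Sup {\<bar>f q - f p\<bar> / dist p q |p q. p \<in> M \<and> q \<in> M \<and> p \<noteq> q}"

definition SNA :: "'a::metric_space set \<Rightarrow> 'a \<Rightarrow> ('a \<Rightarrow> real) set" where
  "SNA M z = {f \<in> Lip0 M z. \<exists>p\<in>M. \<exists>q\<in>M. p \<noteq> q \<and> lip_norm M f = \<bar>f p - f q\<bar> / dist p q}"

text \<open>The normed space \<open>Y\<close> is given as a subspace of a normed vector space; only the values of
  \<open>U\<close> on \<open>Y\<close> matter.\<close>

definition linear_isometric_embedding_Lip0 ::
  "'b::real_normed_vector set \<Rightarrow> 'a::metric_space set \<Rightarrow> 'a \<Rightarrow> ('b \<Rightarrow> 'a \<Rightarrow> real) \<Rightarrow> bool" where
  "linear_isometric_embedding_Lip0 Y M z U \<longleftrightarrow>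
     U ` Y \<subseteq> Lip0 M z \<and>
     (\<forall>x\<in>Y. \<forall>y\<in>Y. U (x + y) = (\<lambda>p. U x p + U y p)) \<and>
     (\<forall>c. \<forall>x\<in>Y. U (c *\<^sub>R x) = (\<lambda>p. c * U x p)) \<and>
     (\<forall>x\<in>Y. lip_norm M (U x) = norm x)"

definition SNA_contains_isometric_copy ::
  "'a::metric_space set \<Rightarrow> 'a \<Rightarrow> 'b::real_normed_vector set \<Rightarrow> bool" where
  "SNA_contains_isometric_copy M z Y \<longleftrightarrow>
     (\<exists>U. linear_isometric_embedding_Lip0 Y M z U \<and> U ` Y \<subseteq> SNA M z)"

text \<open>Since \<^typ>\<open>nat\<close> is discrete, \<^typ>\<open>nat \<Rightarrow>\<^sub>C real\<close> consists of all bounded real sequences with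
  the supremum norm; \<open>c0\<close> inherits this norm.\<close>

definition c0 :: "(nat \<Rightarrow>\<^sub>C real) set" where
  "c0 = {x. (\<lambda>n. apply_bcontfun x n) \<longlonglongrightarrow> 0}"

lemma subspace_c0: "subspace c0"
  unfolding subspace_def c0_def
  by (auto intro!: tendsto_eq_intros)

lemma apply_bcontfun_image_c0: "apply_bcontfun ` c0 = {x. x \<longlonglongrightarrow> 0}"
proof (intro equalityI subsetI)
  fix x :: "nat \<Rightarrow> real" assume "x \<in> {x. x \<longlonglongrightarrow> 0}"
  then have x: "x \<longlonglongrightarrow> 0" by simp
  then have "x \<in> bcontfun"
    by (auto simp: bcontfun_def convergent_imp_bounded)
  then obtain y where "x = apply_bcontfun y" by (rule bcontfunE)
  with x show "x \<in> apply_bcontfun ` c0" by (auto simp: c0_def)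
qed (auto simp: c0_def)

lemma norm_bcontfun_eq_SUP:
  fixes x :: "nat \<Rightarrow>\<^sub>C real"
  shows "norm x = (SUP n. \<bar>apply_bcontfun x n\<bar>)"
  by (simp add: norm_bcontfun_def dist_bcontfun_def dist_real_def)

end

theory Submission
  imports Defs
begin

text \<open>
  Let \<open>a\<close> be a limit point of \<open>M\<close>. The copy of \<open>c0\<close> is spanned by functions \<open>g n\<close>, each a
  difference of two tents of heights \<open>u n\<close> and \<open>v n\<close>, centred at \<open>p n\<close> and \<open>q n\<close>, with
  \<open>u n + v n = dist (p n) (q n)\<close>; thus \<open>g n\<close> has slope \<open>1\<close> between \<open>p n\<close> and \<open>q n\<close>. If the balls
  of all these tents do not overlap (in the sense that the sum of two radii is at most the distance
  of the centres), then \<open>\<Sum>n. x n * g n\<close> has Lipschitz constant \<open>sup \<bar>x n\<bar>\<close>, and it attains it at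
  \<open>p n, q n\<close> for every \<open>n\<close> at which \<open>\<bar>x n\<bar>\<close> is maximal; such \<open>n\<close> exists as \<open>x n\<close> tends to \<open>0\<close>.

  If there are pairs \<open>p, q\<close> arbitrarily close to \<open>a\<close> with \<open>dist p q < dist p a + dist q a\<close>, then
  \<open>u < dist p a\<close> and \<open>v < dist q a\<close> can be chosen, and the strict inequalities leave room
  around \<open>a\<close> for the subsequent pairs. Otherwise \<open>dist p q = dist p a + dist q a\<close> for all distinct
  \<open>p, q\<close> near \<open>a\<close>, and one takes distinct points \<open>p n\<close> near \<open>a\<close> with \<open>q n = a\<close>, \<open>u n = dist (p n) a\<close>
  and \<open>v n = 0\<close>.
\<close>

section \<open>Tents, dipoles and their combinations\<close>

definition tent :: "'a::metric_space \<Rightarrow> real \<Rightarrow> 'a \<Rightarrow> real" where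
  "tent c r x = max 0 (r - dist x c)"

lemma tent_nonneg: "0 \<le> tent c r x"
  by (simp add: tent_def)

lemma tent_centre: "0 \<le> r \<Longrightarrow> tent c r c = r"
  by (simp add: tent_def)

lemma tent_eq_0: "r \<le> dist x c \<Longrightarrow> tent c r x = 0"
  by (simp add: tent_def)

lemma tent_lipschitz: "\<bar>tent c r x - tent c r y\<bar> \<le> dist x y"
  using dist_triangle[of x c y] dist_triangle[of y c x] dist_commute[of x y]
  by (auto simp: tent_def)

text \<open>Where both tents are positive, the sum is \<open>r + s - dist x c - dist y d\<close>,
  and the triangle inequality along c, x, y, d bounds it. For \<open>x = y\<close> this makes the
  supports disjoint.\<close>

lemma tent_add_le:
  assumes "r + s \<le> dist c d" "tent c r x \<noteq> 0" "tent d s y \<noteq> 0"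
  shows "tent c r x + tent d s y \<le> dist x y"
  using assms dist_triangle[of c d x] dist_triangle[of x d y] dist_commute[of x c]
  by (auto simp: tent_def max_def split: if_splits)

text \<open>Only the balls are kept apart, not the centres: where the \<open>v n\<close> vanish, the
  \<open>q n\<close> may all coincide.\<close>

locale dipoles =
  fixes p q :: "nat \<Rightarrow> 'a::metric_space" and u v :: "nat \<Rightarrow> real"
  assumes u_nonneg: "0 \<le> u n" and v_nonneg: "0 \<le> v n"
    and uv: "u n + v n = dist (p n) (q n)" and p_neq_q: "p n \<noteq> q n"
    and uu: "m \<noteq> n \<Longrightarrow> u m + u n \<le> dist (p m) (p n)"
    and uv': "m \<noteq> n \<Longrightarrow> u m + v n \<le> dist (p m) (q n)"
    and vv: "m \<noteq> n \<Longrightarrow> v m + v n \<le> dist (q m) (q n)"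
begin

definition g :: "nat \<Rightarrow> 'a \<Rightarrow> real" where
  "g n x = tent (p n) (u n) x - tent (q n) (v n) x"

lemma tents_disjoint: "tent (p n) (u n) x = 0 \<or> tent (q n) (v n) x = 0"
  using tent_add_le[of "u n" "v n" "p n" "q n" x x] uv[of n]
    tent_nonneg[of "p n" "u n" x] tent_nonneg[of "q n" "v n" x]
  by fastforce

lemma g_lipschitz: "\<bar>g n x - g n y\<bar> \<le> dist x y"
proof -
  let ?s = "tent (p n) (u n)" and ?t = "tent (q n) (v n)"
  have "?s x \<noteq> 0 \<Longrightarrow> ?t y \<noteq> 0 \<Longrightarrow> ?s x + ?t y \<le> dist x y"
    and "?s y \<noteq> 0 \<Longrightarrow> ?t x \<noteq> 0 \<Longrightarrow> ?s y + ?t x \<le> dist x y"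
    using tent_add_le[of "u n" "v n" "p n" "q n" x y] tent_add_le[of "u n" "v n" "p n" "q n" y x]
      uv[of n] by (auto simp: dist_commute)
  then show ?thesis
    using tents_disjoint[of n x] tents_disjoint[of n y]
      tent_lipschitz[of "p n" "u n" x y] tent_lipschitz[of "q n" "v n" x y]
      tent_nonneg[of "p n" "u n" x] tent_nonneg[of "q n" "v n" x]
      tent_nonneg[of "p n" "u n" y] tent_nonneg[of "q n" "v n" y]
    unfolding g_def by (smt (verit))
qed

text \<open>Each absolute value is the value of a single tent, so \<open>tent_add_le\<close> applies
  to tents of different dipoles.\<close>

lemma abs_g_add_le:
  assumes "m \<noteq> n" "g m x \<noteq> 0" "g n y \<noteq> 0"
  shows "\<bar>g m x\<bar> + \<bar>g n y\<bar> \<le> dist x y"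
proof -
  have *: "\<exists>c r. \<bar>g k w\<bar> = tent c r w \<and> (c = p k \<and> r = u k \<or> c = q k \<and> r = v k)" for k w
    using tents_disjoint[of k w] tent_nonneg[of "p k" "u k" w] tent_nonneg[of "q k" "v k" w]
    unfolding g_def by (smt (verit))
  obtain c r d s where c: "\<bar>g m x\<bar> = tent c r x" "c = p m \<and> r = u m \<or> c = q m \<and> r = v m"
    and d: "\<bar>g n y\<bar> = tent d s y" "d = p n \<and> s = u n \<or> d = q n \<and> s = v n"
    using *[of m x] *[of n y] by blast
  have "r + s \<le> dist c d"
    using c(2) d(2) assms(1) uu[of m n] uv'[of m n] uv'[of n m] vv[of m n]
    by (auto simp: dist_commute)
  with tent_add_le[of r s c d x y] c(1) d(1) assms(2,3) show ?thesis
    by auto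
qed

lemma g_unique:
  obtains n where "\<And>k. k \<noteq> n \<Longrightarrow> g k x = 0"
proof (cases "\<exists>n. g n x \<noteq> 0")
  case True
  then obtain n where n: "g n x \<noteq> 0" by blast
  have "g k x = 0" if "k \<noteq> n" for k
    using abs_g_add_le[of k n x x] that n by fastforce
  then show thesis by (rule that)
qed (use that in blast)

lemma summable_g: "summable (\<lambda>n. c n * g n x)"
proof -
  obtain n where "\<And>k. k \<noteq> n \<Longrightarrow> g k x = 0" using g_unique[of x] by blast
  then show ?thesis by (intro summable_finite[of "{n}"]) auto
qed

text \<open>By \<open>g_unique\<close> at most one term is nonzero at each point, so no decay of
  \<open>c\<close> is needed for convergence.\<close>

definition comb :: "(nat \<Rightarrow> real) \<Rightarrow> 'a \<Rightarrow> real" where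
  "comb c x = (\<Sum>n. c n * g n x)"

lemma comb_eq:
  assumes "\<And>k. k \<noteq> n \<Longrightarrow> g k x = 0"
  shows "comb c x = c n * g n x"
  unfolding comb_def using suminf_finite[of "{n}" "\<lambda>n. c n * g n x"] assms by auto

lemma comb_add: "comb (\<lambda>n. c n + d n) x = comb c x + comb d x"
  unfolding comb_def by (simp add: suminf_add[OF summable_g summable_g] distrib_right)

lemma comb_scale: "comb (\<lambda>n. t * c n) x = t * comb c x"
  unfolding comb_def by (simp add: suminf_mult[OF summable_g, symmetric] mult.assoc)

lemma comb_lipschitz:
  assumes c: "\<And>n. \<bar>c n\<bar> \<le> C"
  shows "\<bar>comb c x - comb c y\<bar> \<le> C * dist x y"
proof -
  have C: "0 \<le> C" using c[of 0] by linarith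
  obtain m where m: "\<And>k. k \<noteq> m \<Longrightarrow> g k x = 0" using g_unique[of x] by blast
  obtain n where n: "\<And>k. k \<noteq> n \<Longrightarrow> g k y = 0" using g_unique[of y] by blast
  have same: ?thesis if "\<And>j. j \<noteq> k \<Longrightarrow> g j x = 0" "\<And>j. j \<noteq> k \<Longrightarrow> g j y = 0" for k
  proof -
    have "\<bar>comb c x - comb c y\<bar> = \<bar>c k\<bar> * \<bar>g k x - g k y\<bar>"
      using comb_eq[of k x c] comb_eq[of k y c] that
      by (simp flip: abs_mult right_diff_distrib)
    also have "\<dots> \<le> C * dist x y"
      by (intro mult_mono c g_lipschitz C) auto
    finally show ?thesis .
  qed
  show ?thesis
  proof (cases "m \<noteq> n \<and> g m x \<noteq> 0 \<and> g n y \<noteq> 0")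
    case True
    have "\<bar>comb c x - comb c y\<bar> \<le> \<bar>c m\<bar> * \<bar>g m x\<bar> + \<bar>c n\<bar> * \<bar>g n y\<bar>"
      using comb_eq[of m x c] comb_eq[of n y c] m n
        abs_triangle_ineq4[of "c m * g m x" "c n * g n y"] by (simp add: abs_mult)
    also have "\<dots> \<le> C * \<bar>g m x\<bar> + C * \<bar>g n y\<bar>"
      by (intro add_mono mult_right_mono c) auto
    also have "\<dots> \<le> C * dist x y"
      using abs_g_add_le[of m n x y] True C by (simp add: mult_left_mono flip: distrib_left)
    finally show ?thesis .
  next
    case False
    \<comment> \<open>If \<open>g m x = 0\<close>, every \<open>g k\<close> vanishes at
      \<open>x\<close>, so \<open>n\<close> serves both points; symmetrically for
      \<open>y\<close>.\<close>
    then show ?thesis using same[of m] same[of n] m n by metis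
  qed
qed

lemma comb_slope: "\<bar>comb c (p n) - comb c (q n)\<bar> = \<bar>c n\<bar> * dist (p n) (q n)"
proof -
  \<comment> \<open>As radii are nonnegative, the centres of dipole \<open>n\<close> lie outside the
    open balls of all other tents.\<close>
  have 0: "g k (p n) = 0" "g k (q n) = 0" if "k \<noteq> n" for k
    using that uu[of n k] uv'[of n k] uv'[of k n] vv[of n k] u_nonneg[of n] v_nonneg[of n]
    by (auto simp: g_def tent_eq_0 dist_commute)
  have "g n (p n) = u n" "g n (q n) = - v n"
    using uv[of n] u_nonneg[of n] v_nonneg[of n]
    by (auto simp: g_def tent_centre tent_eq_0 dist_commute)
  then have "comb c (p n) - comb c (q n) = c n * (u n + v n)"
    using comb_eq[of n "p n" c] comb_eq[of n "q n" c] 0 by (simp add: distrib_left)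
  then show ?thesis by (simp add: uv abs_mult)
qed

end

section \<open>From dipoles to a copy of c0\<close>

lemma c0_norm_attained:
  assumes "x \<in> c0"
  obtains n where "norm x = \<bar>apply_bcontfun x n\<bar>"
proof (cases "x = 0")
  case False
  then have pos: "norm x > 0" by simp
  let ?f = "\<lambda>n. \<bar>apply_bcontfun x n\<bar>"
  have "?f \<longlonglongrightarrow> 0"
    using assms by (simp add: c0_def tendsto_rabs_zero)
  then have "\<forall>\<^sub>F n in sequentially. ?f n < norm x / 2"
    using pos by (intro order_tendstoD) auto
  then obtain N where N: "\<And>n. n \<ge> N \<Longrightarrow> ?f n < norm x / 2"
    by (auto simp: eventually_sequentially)
  \<comment> \<open>Entries from \<open>N\<close> on stay below half the norm, so the supremum is a
    maximum over finitely many entries.\<close>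
  define S where "S = Max (?f ` {..N})"
  have S: "?f n \<le> S" if "n \<le> N" for n
    unfolding S_def using that by (intro Max_ge) auto
  have "S \<in> ?f ` {..N}"
    unfolding S_def by (intro Max_in) auto
  then obtain n where n: "S = ?f n" by auto
  have "norm (apply_bcontfun x n) \<le> max S (norm x / 2)" for n
    using S[of n] N[of n] by (cases "n \<le> N") auto
  then have "norm x \<le> max S (norm x / 2)"
    by (rule norm_bound)
  with pos have "norm x \<le> ?f n" using n by auto
  moreover have "?f n \<le> norm x"
    using norm_bounded[of x n] by simp
  ultimately show ?thesis using that[of n] by linarith
qed (use that[of 0] in simp)

lemma lip_norm_eqI:
  assumes lip: "\<And>x y. x \<in> M \<Longrightarrow> y \<in> M \<Longrightarrow> \<bar>f x - f y\<bar> \<le> C * dist x y"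
    and pq: "p \<in> M" "q \<in> M" "p \<noteq> q" "\<bar>f p - f q\<bar> = C * dist p q"
  shows "lip_norm M f = C"
  unfolding lip_norm_def
proof (rule cSup_eq_maximum)
  show "C \<in> {\<bar>f q - f p\<bar> / dist p q |p q. p \<in> M \<and> q \<in> M \<and> p \<noteq> q}"
    using pq by (intro CollectI exI[of _ p] exI[of _ q]) (auto simp: abs_minus_commute)
next
  fix t assume "t \<in> {\<bar>f q - f p\<bar> / dist p q |p q. p \<in> M \<and> q \<in> M \<and> p \<noteq> q}"
  then show "t \<le> C"
    using lip by (auto simp: divide_le_eq abs_minus_commute)
qed

lemma (in dipoles) SNA_contains_c0:
  assumes "range p \<subseteq> M" "range q \<subseteq> M" "z \<in> M"
  shows "SNA_contains_isometric_copy M z c0"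
proof -
  \<comment> \<open>Subtracting the value at \<open>z\<close> normalises the function and leaves its
    slopes on \<open>M\<close> unchanged.\<close>
  define U where
    "U = (\<lambda>x w. if w \<in> M then comb (apply_bcontfun x) w - comb (apply_bcontfun x) z else 0)"
  have lip: "\<bar>U x w - U x w'\<bar> \<le> norm x * dist w w'" if "w \<in> M" "w' \<in> M" for x w w'
    using comb_lipschitz[of "apply_bcontfun x" "norm x" w w'] norm_bounded[of x] that
    by (simp add: U_def)
  have Lip0: "U x \<in> Lip0 M z" for x
    using lip[of _ _ x] assms(3)
    by (auto simp: Lip0_def lipschitz_on_def dist_real_def intro!: exI[of _ "norm x"])
      (auto simp: U_def)
  have att: "lip_norm M (U x) = norm x \<and> U x \<in> SNA M z" if "x \<in> c0" for x
  proof -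
    obtain n where n: "norm x = \<bar>apply_bcontfun x n\<bar>"
      using c0_norm_attained[OF \<open>x \<in> c0\<close>] by blast
    have slope: "\<bar>U x (p n) - U x (q n)\<bar> = norm x * dist (p n) (q n)"
      using assms comb_slope[of "apply_bcontfun x" n] by (auto simp: U_def n range_subsetD)
    have norm: "lip_norm M (U x) = norm x"
      by (rule lip_norm_eqI[OF lip _ _ p_neq_q slope]) (use assms in auto)
    moreover have "U x \<in> SNA M z"
      unfolding SNA_def mem_Collect_eq using assms p_neq_q[of n]
      by (intro conjI Lip0 bexI[of _ "p n"] bexI[of _ "q n"]) (auto simp: norm slope)
    ultimately show ?thesis by simp
  qed
  have "U (x + y) = (\<lambda>w. U x w + U y w)" for x y
    by (auto simp: U_def comb_add)
  moreover have "U (t *\<^sub>R x) = (\<lambda>w. t * U x w)" for t x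
    by (auto simp: U_def comb_scale right_diff_distrib)
  ultimately show ?thesis
    unfolding SNA_contains_isometric_copy_def linear_isometric_embedding_Lip0_def
    using att Lip0 by (intro exI[of _ U]) auto
qed

section \<open>Dipoles near a limit point\<close>

lemma split_less:
  fixes A B D :: real
  assumes "0 < A" "0 < B" "0 \<le> D" "D < A + B"
  obtains u v where "0 \<le> u" "0 \<le> v" "u < A" "v < B" "u + v = D"
proof
  \<comment> \<open>\<open>A\<close> and \<open>B\<close> are scaled by the common factor
    \<open>D / (A + B) < 1\<close>.\<close>
  let ?u = "D * A / (A + B)" and ?v = "D * B / (A + B)"
  show "0 \<le> ?u" "0 \<le> ?v" using assms by auto
  show "?u < A" "?v < B" using assms by (simp_all add: divide_less_eq mult.commute)
  show "?u + ?v = D"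
    using assms by (simp flip: add_divide_distrib distrib_left)
qed

lemma dipoles_near_tight:
  fixes a :: "'a::metric_space"
  assumes "a islimpt M" "0 < \<delta>"
    and tight: "\<And>p q. p \<in> M \<Longrightarrow> q \<in> M \<Longrightarrow> p \<noteq> q \<Longrightarrow> dist p a < \<delta> \<Longrightarrow> dist q a < \<delta> \<Longrightarrow>
      dist p a + dist q a \<le> dist p q"
  obtains p where "range p \<subseteq> M" "dipoles p (\<lambda>_. a) (\<lambda>n. dist (p n) a) (\<lambda>_. 0)"
proof -
  have "infinite (M \<inter> ball a \<delta> - {a})"
    using assms(1,2) by (simp add: islimpt_eq_infinite_ball)
  then obtain p :: "nat \<Rightarrow> 'a" where p: "inj p" "range p \<subseteq> M \<inter> ball a \<delta> - {a}"
    using infinite_countable_subset by blast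
  then have "p n \<in> M \<and> dist (p n) a < \<delta> \<and> p n \<noteq> a" for n
    using range_subsetD[OF p(2), of n] by (simp add: dist_commute)
  \<comment> \<open>Injectivity of \<open>p\<close> lets \<open>tight\<close> give the condition
    \<open>uu\<close>; the mixed conditions hold with equality.\<close>
  with p tight have "dipoles p (\<lambda>_. a) (\<lambda>n. dist (p n) a) (\<lambda>_. 0)"
    by unfold_locales (auto simp: inj_eq)
  with p that show thesis by blast
qed

lemma dipoles_near_slack:
  fixes a :: "'a::metric_space"
  assumes slack: "\<And>\<delta>. 0 < \<delta> \<Longrightarrow> \<exists>p\<in>M. \<exists>q\<in>M. p \<noteq> q \<and> dist p a < \<delta> \<and> dist q a < \<delta> \<and>
      dist p q < dist p a + dist q a"
  obtains p q u v where "range p \<subseteq> M" "range q \<subseteq> M" "dipoles p q u v"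
proof -
  define good where "good = (\<lambda>(p, q, u, v). p \<in> M \<and> q \<in> M \<and> p \<noteq> q \<and> 0 \<le> u \<and> 0 \<le> v \<and>
    u < dist p a \<and> v < dist q a \<and> u + v = dist p q)"
  \<comment> \<open>Half the slack suffices: a later centre \<open>d\<close> has radius below
    \<open>dist d a\<close>, and passing from \<open>a\<close> to \<open>d\<close> costs another
    \<open>dist d a\<close>; see \<open>sep\<close>.\<close>
  define room where "room = (\<lambda>(p, q, u, v). min (dist p a - u) (dist q a - v) / 2)"
  define near where "near = (\<lambda>(p, q, u :: real, v :: real) \<delta>. dist p a < \<delta> \<and> dist q a < \<delta>)"
  have ex: "\<exists>w. good w \<and> near w \<delta>" if "0 < \<delta>" for \<delta>
  proof -
    obtain p q where pq: "p \<in> M" "q \<in> M" "p \<noteq> q" "dist p a < \<delta>" "dist q a < \<delta>"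
      "dist p q < dist p a + dist q a"
      using slack[OF \<open>0 < \<delta>\<close>] by blast
    then have "p \<noteq> a" "q \<noteq> a" by (auto simp: dist_commute)
    then obtain u v where "0 \<le> u" "0 \<le> v" "u < dist p a" "v < dist q a" "u + v = dist p q"
      using split_less[of "dist p a" "dist q a" "dist p q"] pq(6) by auto
    with pq show ?thesis
      by (intro exI[of _ "(p, q, u, v)"]) (auto simp: good_def near_def)
  qed
  have room_pos: "0 < room w" if "good w" for w
    using that by (auto simp: good_def room_def)
  obtain w where w: "\<And>n. good (w n)" "\<And>n. near (w (Suc n)) (room (w n))"
    using dependent_nat_choice[of "\<lambda>_. good" "\<lambda>_ x y. near y (room x)"] ex room_pos zero_less_one
    by metis
  \<comment> \<open>Rooms therefore decrease along the sequence, so closeness relative to the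
    preceding pair implies it for all earlier pairs.\<close>
  have room_less: "room x < \<delta>" if "good x" "near x \<delta>" for x \<delta>
    using that by (auto simp: good_def near_def room_def)
  have dec: "room (w n) \<le> room (w m)" if "m \<le> n" for m n
    using that by (rule lift_Suc_antimono_le[rotated]) (rule less_imp_le[OF room_less[OF w]])
  have later: "near (w n) (room (w m))" if "m < n" for m n
  proof -
    obtain k where k: "n = Suc k" "m \<le> k" using \<open>m < n\<close> by (cases n) auto
    show ?thesis
      using w(2)[of k] dec[OF k(2)] unfolding k(1) near_def by auto
  qed
  define p q u v where "p = (\<lambda>n. fst (w n))" and "q = (\<lambda>n. fst (snd (w n)))"
    and "u = (\<lambda>n. fst (snd (snd (w n))))" and "v = (\<lambda>n. snd (snd (snd (w n))))"
  have w_eq: "w n = (p n, q n, u n, v n)" for n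
    by (simp add: p_def q_def u_def v_def)
  have good: "p n \<in> M" "q n \<in> M" "p n \<noteq> q n" "0 \<le> u n" "0 \<le> v n"
    "u n < dist (p n) a" "v n < dist (q n) a" "u n + v n = dist (p n) (q n)" for n
    using w(1)[of n] by (auto simp: w_eq good_def)
  have near: "2 * dist (p n) a < dist (p m) a - u m" "2 * dist (p n) a < dist (q m) a - v m"
      "2 * dist (q n) a < dist (p m) a - u m" "2 * dist (q n) a < dist (q m) a - v m"
    if "m < n" for m n
    using later[OF that] by (auto simp: w_eq near_def room_def)
  have sep: "r + s \<le> dist c d" if "2 * dist d a < dist c a - r" "s < dist d a" for r s and c d :: 'a
    using that dist_triangle[of c a d] by linarith
  have lt: "u m + u n \<le> dist (p m) (p n)" "u m + v n \<le> dist (p m) (q n)"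
    "v m + u n \<le> dist (q m) (p n)" "v m + v n \<le> dist (q m) (q n)" if "m < n" for m n
    using near[OF that] good[of n] by (auto intro: sep)
  have "dipoles p q u v"
  proof
    fix m n :: nat
    assume "m \<noteq> n"
    then consider "m < n" | "n < m" by linarith
    then show "u m + u n \<le> dist (p m) (p n)" "u m + v n \<le> dist (p m) (q n)"
      "v m + v n \<le> dist (q m) (q n)"
      by (cases; use lt[of m n] lt[of n m] in \<open>simp add: dist_commute add.commute\<close>)+
  qed (use good in auto)
  with good that show thesis by blast
qed

theorem corollary4p3:
  fixes M :: "'a::metric_space set" and z :: 'a
  assumes "compact M" and "infinite M" and "z \<in> M"
  shows "SNA_contains_isometric_copy M z c0"
proof -
  obtain a where a: "a \<in> M" "a islimpt M"
    using assms(1,2) by (meson compact_eq_Bolzano_Weierstrass order_refl)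
  show ?thesis
  proof (cases "\<forall>\<delta>>0. \<exists>p\<in>M. \<exists>q\<in>M. p \<noteq> q \<and> dist p a < \<delta> \<and> dist q a < \<delta> \<and>
      dist p q < dist p a + dist q a")
    case True
    then obtain p q u v where "range p \<subseteq> M" "range q \<subseteq> M" "dipoles p q u v"
      using dipoles_near_slack[of M a] by blast
    then show ?thesis using dipoles.SNA_contains_c0 assms(3) by blast
  next
    case False
    then obtain \<delta> where "0 < \<delta>" and \<delta>: "\<And>p q. p \<in> M \<Longrightarrow> q \<in> M \<Longrightarrow> p \<noteq> q \<Longrightarrow> dist p a < \<delta> \<Longrightarrow>
        dist q a < \<delta> \<Longrightarrow> dist p a + dist q a \<le> dist p q"
      by (meson not_less)
    obtain p where "range p \<subseteq> M" "dipoles p (\<lambda>_. a) (\<lambda>n. dist (p n) a) (\<lambda>_. 0)"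
      using dipoles_near_tight[OF a(2) \<open>0 < \<delta>\<close> \<delta>] by blast
    then show ?thesis using dipoles.SNA_contains_c0[of p "\<lambda>_. a"] assms(3) a(1) by auto
  qed
qed

end
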